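(* Let $\ell\ge 3$ and $n=2^\ell$. For every anchor-decodable sequence $s_\ell$, the encoding map $\phi:\{0,1\}^{k(s_\ell)}\to\{0,1\}^n$ associated with $s_\ell$ is one-to-one. Furthermore, for every $\mathbf{x}\in\{0,1\}^{k(s_\ell)}$, where $k(s_\ell)=\sum_{i=1}^{\ell}s_\ell(i)$, the decoding algorithm Decode (run with $s_\ell$) outputs $\mathbf{x}$ when given $\phi(\mathbf{x})\in\{0,1\}^{2^\ell}$ as input.
   Context: For a vector $\mathbf{g}=(g[0],\dots,g[\ell-1])$ and an integer $\ell_0$ (taken mod $\ell$), $\mathrm{cshift}(\mathbf{g},\ell_0)=(g[\ell_0],g[\ell_0+1],\dots,g[\ell-1],g[0],\dots,g[\ell_0-1])$. Anchor-decodable: let $\ell\ge3$. A non-decreasing sequence of non-negative integers $s_\ell=(s_\ell(1),\dots,s_\ell(\ell))$ is anchor-decodable if $s_\ell(\ell)=\ell$ and (1) $2^\ell-\sum_{i=1}^{\ell-1}2^{s_\ell(i)}\ \ge\ 2^{s_\ell(\ell-1)}$; (2) the vector $\boldsymbol\gamma=\left(2^\ell-1-\sum_{i=1}^{\ell-1}2^{s_\ell(i)},\ 2^{s_\ell(\ell-1)}-1,\ 2^{s_\ell(\ell-2)}-1,\dots,2^{s_\ell(1)}-1\right)$ satisfies $\mathrm{cshift}(\boldsymbol\gamma,\ell_0)\ne\boldsymbol\gamma$ for every integer $0<\ell_0<\ell$. For a binary vector $\mathbf{y}$, $\mathrm{dec}(\mathbf{y})$ is its decimal value, most significant bit first (the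 empty vector has value $0$). Encoding map $\phi:\{0,1\}^{k(s_\ell)}\to\{0,1\}^n$, $n=2^\ell$: write $\mathbf{x}=\mathbf{x}_\ell\Vert\mathbf{x}_{\ell-1}\Vert\cdots\Vert\mathbf{x}_1$ (concatenation) with $|\mathbf{x}_i|=s_\ell(i)$. Start with $\mathbf{c}=0^n$ (coordinates indexed $0,\dots,n-1$) and $\mathrm{pos}=-1$. For $j=\ell,\ell-1,\dots,1$ in this order, replace $\mathrm{pos}$ by $(\mathrm{pos}+1+\mathrm{dec}(\mathbf{x}_j)) \bmod n$ and set $c[\mathrm{pos}]=1$. The output is $\phi(\mathbf{x})=\mathbf{c}$. For $\mathbf{x}$ in the domain, $\phi(\mathbf{x})$ has exactly $\ell$ ones, so the following is well defined. Decode (input $\mathbf{c}\in\mathrm{Im}(\phi)$ and $s_\ell$): let $0\le j[0]<j[1]<\cdots<j[\ell-1]<n$ be the positions of the ones of $\mathbf{c}$. Put $\mathbf{g}[m]=(j[m]-j[(m-1)\bmod \ell]-1)\bmod n$ for $m=0,\dots,\ell-1$. Determine an index $A\in\{0,\dots,\ell-1\}$: if there is $n_0\in\{0,\dots,\ell-1\}$ with $\mathrm{cshift}(\mathbf{g},n_0)=\boldsymbol\gamma$, set $A=n_0$; otherwise set $A=\arg\max_{0\le m\le \ell-1}\mathbf{g}[m]$. Output the concatenation of the length-$\ell$ binary representation of $j[A]$ followed, for $i=1,2,\dots,\ell-1$ in this order, by the binary representation of $\mathbf{g}[(A+i)\bmod\ell]$ of length $s_\ell(\ell-i)$. (Correctness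 of the output includes that these representations exist and the choices of $A$ are unambiguous.) *)

theory Defs
  imports Main
begin

text \<open>
  Bit vectors are Boolean lists. A sequence \<open>(s(1), \<dots>, s(l))\<close> is a function
  \<open>s :: nat \<Rightarrow> nat\<close> of which only the values on \<open>{1..l}\<close> are used. Positions, gaps and the
  entries of \<open>\<gamma>\<close> are integers, so that subtraction is not truncated. The cyclic shift
  \<open>cshift(g, l0)\<close> is the library function \<^term>\<open>rotate l0 g\<close>.
\<close>

definition bitvecs :: "nat \<Rightarrow> bool list set" where
  "bitvecs k = {x. length x = k}"

definition total_bits :: "nat \<Rightarrow> (nat \<Rightarrow> nat) \<Rightarrow> nat" where
  "total_bits l s = (\<Sum>i = 1..l. s i)"

definition gamma_vec :: "nat \<Rightarrow> (nat \<Rightarrow> nat) \<Rightarrow> int list" where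
  "gamma_vec l s =
     (2 ^ l - 1 - (\<Sum>i = 1..l - 1. 2 ^ s i)) # map (\<lambda>i. 2 ^ s i - 1) (rev [1..<l])"

definition anchor_decodable :: "nat \<Rightarrow> (nat \<Rightarrow> nat) \<Rightarrow> bool" where
  "anchor_decodable l s \<longleftrightarrow>
     mono_on {1..l} s \<and> s l = l \<and>
     (2 ^ l :: int) - (\<Sum>i = 1..l - 1. 2 ^ s i) \<ge> 2 ^ s (l - 1) \<and>
     (\<forall>l0. 0 < l0 \<and> l0 < l \<longrightarrow> rotate l0 (gamma_vec l s) \<noteq> gamma_vec l s)"

text \<open>The library's \<^const>\<open>horner_sum\<close> is least significant digit first, hence the reversal.\<close>

definition dec :: "bool list \<Rightarrow> int" where
  "dec y = horner_sum of_bool 2 (rev y)"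

text \<open>The block \<open>x\<^sub>j\<close> of \<open>x = x\<^sub>l \<parallel> x\<^sub>l\<^sub>-\<^sub>1 \<parallel> \<dots> \<parallel> x\<^sub>1\<close>.\<close>

definition block :: "nat \<Rightarrow> (nat \<Rightarrow> nat) \<Rightarrow> bool list \<Rightarrow> nat \<Rightarrow> bool list" where
  "block l s x j = take (s j) (drop (\<Sum>i = j + 1..l. s i) x)"

definition encode_step ::
  "nat \<Rightarrow> (nat \<Rightarrow> nat) \<Rightarrow> bool list \<Rightarrow> nat \<Rightarrow> int \<times> bool list \<Rightarrow> int \<times> bool list" where
  "encode_step l s x j = (\<lambda>(pos, c).
     let pos' = (pos + 1 + dec (block l s x j)) mod 2 ^ l in (pos', c[nat pos' := True]))"

definition encode :: "nat \<Rightarrow> (nat \<Rightarrow> nat) \<Rightarrow> bool list \<Rightarrow> bool list" where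
  "encode l s x =
     snd (fold (encode_step l s x) (rev [1..<l + 1]) (- 1, replicate (2 ^ l) False))"

definition ones :: "bool list \<Rightarrow> nat list" where
  "ones c = filter (\<lambda>i. c ! i) [0..<length c]"

text \<open>Here \<open>(m + l - 1) mod l\<close> is \<open>(m - 1) mod l\<close> without truncated subtraction.\<close>

definition gaps :: "nat \<Rightarrow> nat list \<Rightarrow> int list" where
  "gaps l js =
     map (\<lambda>m. (int (js ! m) - int (js ! ((m + l - 1) mod l)) - 1) mod 2 ^ l) [0..<l]"

definition is_anchor :: "nat \<Rightarrow> (nat \<Rightarrow> nat) \<Rightarrow> int list \<Rightarrow> nat \<Rightarrow> bool" where
  "is_anchor l s g A \<longleftrightarrow> A < l \<and>
     (if \<exists>n0 < l. rotate n0 g = gamma_vec l s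
      then rotate A g = gamma_vec l s
      else is_arg_max (\<lambda>m. g ! m) (\<lambda>m. m < l) A)"

text \<open>
  The representation of \<open>v\<close> by exactly \<open>w\<close> bits, most significant bit first;
  \<^const>\<open>None\<close> if there is none.
\<close>

definition bin_rep :: "nat \<Rightarrow> int \<Rightarrow> bool list option" where
  "bin_rep w v = (if 0 \<le> v \<and> v < 2 ^ w then Some (map (bit v) (rev [0..<w])) else None)"

text \<open>
  The result is \<^const>\<open>None\<close> whenever a step of the algorithm is not well defined: the input does
  not have exactly \<open>l\<close> ones, the choice of the anchor index is not unique, or one of the binary
  representations does not exist. So \<open>decode l s c = Some x\<close> asserts well-definedness as well.
\<close>

definition decode :: "nat \<Rightarrow> (nat \<Rightarrow> nat) \<Rightarrow> bool list \<Rightarrow> bool list option" where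
  "decode l s c =
     (let js = ones c; g = gaps l js in
      if length js = l \<and> (\<exists>!A. is_anchor l s g A) then
        let A = (THE A. is_anchor l s g A) in
        map_option concat (those
          (bin_rep l (int (js ! A)) #
           map (\<lambda>i. bin_rep (s (l - i)) (g ! ((A + i) mod l))) [1..<l]))
      else None)"

lemma encode_in_bitvecs: "encode l s x \<in> bitvecs (2 ^ l)"
proof -
  have "length (snd (fold (encode_step l s x) js pc)) = length (snd pc)" for js pc
    by (induction js arbitrary: pc) (auto simp: encode_step_def Let_def split: prod.splits)
  then show ?thesis by (simp add: encode_def bitvecs_def)
qed

lemma bin_rep_eq_Some_iff: "bin_rep w v = Some y \<longleftrightarrow> length y = w \<and> dec y = v"
proof
  assume "bin_rep w v = Some y"
  then have v: "0 \<le> v" "v < 2 ^ w" and y: "y = map (bit v) (rev [0..<w])"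
    by (auto simp: bin_rep_def split: if_splits)
  have "dec y = take_bit w v"
    by (simp add: y dec_def rev_map horner_sum_bit_eq_take_bit)
  with v y show "length y = w \<and> dec y = v"
    by (simp add: take_bit_int_eq_self_iff)
next
  assume *: "length y = w \<and> dec y = v"
  have "take_bit w (dec y) = dec y"
    using * by (auto simp: dec_def take_bit_horner_sum_bit_eq)
  then have "0 \<le> v \<and> v < 2 ^ w"
    using * by (simp add: take_bit_int_eq_self_iff)
  moreover have "map (bit v) (rev [0..<w]) = y"
    using * by (intro nth_equalityI) (auto simp: dec_def bit_horner_sum_bit_iff rev_nth)
  ultimately show "bin_rep w v = Some y"
    by (simp add: bin_rep_def)
qed

end

theory Submission
  imports Defs
begin

text \<open>
  The unreduced positions increase by less than \<open>2 ^ l\<close> in total, so the list of ones, read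
  cyclically from the first marked position on, is the list of marked positions in the order of marking. Its gap
  vector \<open>\<delta>\<close> then satisfies \<open>\<delta>\<^sub>i \<le> \<gamma>\<^sub>i\<close> for \<open>i > 0\<close>, and since the sums of \<open>\<delta>\<close> and
  \<open>\<gamma>\<close> agree, \<open>\<delta>\<^sub>0 \<ge> \<gamma>\<^sub>0 = max \<gamma>\<close> with equality only if \<open>\<delta> = \<gamma>\<close>. In the case of
  equality, the anchor is unique since \<open>\<gamma>\<close> is not fixed by a proper cyclic shift; otherwise \<open>\<delta>\<close>
  is not a rotation of \<open>\<gamma>\<close> and \<open>\<delta>\<^sub>0\<close> is its unique maximum.
\<close>

section \<open>Blocks of the message\<close>

text \<open>Every \<open>y\<close> represents its own value in \<open>length y\<close> bits, so the
  range test in \<open>bin_rep\<close> must have succeeded.\<close>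

lemma dec_bounds: "0 \<le> dec y" "dec y < 2 ^ length y"
  using bin_rep_eq_Some_iff[of "length y" "dec y" y] by (auto simp: bin_rep_def split: if_splits)

lemma rev_upt_conv_map: "rev [1..<l + 1] = map (\<lambda>i. l - i) [0..<l]"
  by (intro nth_equalityI) (auto simp: rev_nth simp del: upt_Suc)

lemma length_block:
  assumes "length x = total_bits l s" "j \<in> {1..l}"
  shows "length (block l s x j) = s j"
proof -
  have "s j + (\<Sum>i = j + 1..l. s i) = (\<Sum>i = j..l. s i)"
    using assms(2) by (simp add: sum.atLeast_Suc_atMost)
  also have "\<dots> \<le> total_bits l s"
    unfolding total_bits_def using assms(2) by (intro sum_mono2) auto
  finally show ?thesis
    using assms(1) by (simp add: block_def)
qed

lemma concat_blocks:
  assumes "length x = total_bits l s"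
  shows "concat (map (\<lambda>i. block l s x (l - i)) [0..<l]) = x"
proof -
  \<comment> \<open>Generalised to the first \<open>m\<close> blocks: they form the prefix that ends
    where block \<open>l - m\<close> starts.\<close>
  have "concat (map (\<lambda>i. block l s x (l - i)) [0..<m]) = take (\<Sum>i = l - m + 1..l. s i) x"
    if "m \<le> l" for m
    using that
  proof (induction m)
    case (Suc m)
    have "l - Suc m + 1 = l - m" using Suc.prems by simp
    moreover have "(\<Sum>i = l - m..l. s i) = (\<Sum>i = l - m + 1..l. s i) + s (l - m)"
      using Suc.prems by (simp add: sum.atLeast_Suc_atMost)
    ultimately show ?case
      using Suc by (simp add: block_def take_add)
  qed auto
  from this[of l] show ?thesis
    using assms by (simp add: total_bits_def)
qed

section \<open>Unreduced positions and the encoder loop\<close>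

definition offset :: "nat \<Rightarrow> (nat \<Rightarrow> nat) \<Rightarrow> bool list \<Rightarrow> nat \<Rightarrow> nat" where
  "offset l s x j = nat (dec (block l s x j))"

text \<open>
  The position marked for \<open>j = l - i\<close>, before reduction modulo \<open>2 ^ l\<close>; the initial \<open>pos = - 1\<close>
  cancels one of the \<open>i + 1\<close> increments.
\<close>

definition mark :: "nat \<Rightarrow> (nat \<Rightarrow> nat) \<Rightarrow> bool list \<Rightarrow> nat \<Rightarrow> nat" where
  "mark l s x i = (\<Sum>k \<le> i. offset l s x (l - k)) + i"

lemma int_offset: "int (offset l s x j) = dec (block l s x j)"
  by (simp add: offset_def dec_bounds)

lemma mark_0: "mark l s x 0 = offset l s x l"
  by (simp add: mark_def)

lemma mark_Suc: "mark l s x (Suc i) = mark l s x i + 1 + offset l s x (l - Suc i)"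
  by (simp add: mark_def)

lemma strict_mono_mark: "strict_mono (mark l s x)"
  by (simp add: strict_mono_Suc_iff mark_Suc)

text \<open>This is the loop invariant. It starts after the first step because the initial position
  \<open>- 1\<close> is not a mark.\<close>

lemma fold_encode_step:
  "fold (encode_step l s x) (map (\<lambda>i. l - i) [0..<Suc m]) (- 1, replicate (2 ^ l) False) =
     (int (mark l s x m mod 2 ^ l),
      map (\<lambda>p. p \<in> (\<lambda>i. mark l s x i mod 2 ^ l) ` {..m}) [0..<2 ^ l])"
proof (induction m)
  case 0
  have "dec (block l s x l) mod 2 ^ l = int (mark l s x 0 mod 2 ^ l)"
    by (simp add: mark_0 int_offset zmod_int)
  then show ?case
    by (auto simp: encode_step_def Let_def intro!: nth_equalityI simp: nth_list_update split: if_splits)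
next
  case (Suc m)
  have "(int (mark l s x m mod 2 ^ l) + 1 + dec (block l s x (l - Suc m))) mod 2 ^ l
      = (int (mark l s x m) + 1 + dec (block l s x (l - Suc m))) mod 2 ^ l"
    by (intro mod_add_cong) (simp_all add: zmod_int)
  also have "\<dots> = int (mark l s x (Suc m) mod 2 ^ l)"
    by (simp add: mark_Suc int_offset zmod_int ac_simps)
  finally have "encode_step l s x (l - Suc m) (int (mark l s x m mod 2 ^ l), c) =
      (int (mark l s x (Suc m) mod 2 ^ l), c[mark l s x (Suc m) mod 2 ^ l := True])" for c
    by (simp add: encode_step_def Let_def)
  with Suc show ?case
    by (auto simp: upt_Suc[of 0 "Suc m"] atMost_Suc simp del: upt_Suc
        intro!: nth_equalityI simp: nth_list_update split: if_splits)
qed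

lemma ones_encode:
  assumes "l > 0"
  shows "ones (encode l s x) = sorted_list_of_set ((\<lambda>i. mark l s x i mod 2 ^ l) ` {..<l})"
    (is "_ = sorted_list_of_set ?M")
proof -
  obtain m where m: "l = Suc m" using assms gr0_conv_Suc by blast
  have "encode l s x = map (\<lambda>p. p \<in> ?M) [0..<2 ^ l]"
    unfolding encode_def rev_upt_conv_map using fold_encode_step[of l s x m]
    by (simp add: m lessThan_Suc_atMost del: upt_Suc)
  then have "ones (encode l s x) = filter (\<lambda>i. i \<in> ?M) [0..<2 ^ l]"
    by (auto simp: ones_def intro!: filter_cong)
  moreover have "set (filter (\<lambda>i. i \<in> ?M) [0..<2 ^ l]) = ?M"
    by auto
  moreover have "sorted (filter (\<lambda>i. i \<in> ?M) [0..<2 ^ l])"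
    "distinct (filter (\<lambda>i. i \<in> ?M) [0..<2 ^ l])"
    by (auto simp: sorted_wrt_filter)
  ultimately show ?thesis
    by (metis sorted_list_of_set.idem_if_sorted_distinct)
qed

section \<open>Cyclic order of the marks\<close>

text \<open>All values lie in a window of length \<open>n\<close> starting at
  \<open>f 0 < n\<close>, so reduction wraps at most once. Rotating the wrapped block to the front
  sorts the list.\<close>

lemma sorted_rotate_mod:
  fixes f :: "nat \<Rightarrow> nat"
  assumes f: "strict_mono f" "f 0 < n" "\<And>i. i < l \<Longrightarrow> f i < f 0 + n"
  obtains k where "k \<le> l" "sorted_wrt (<) (rotate k (map (\<lambda>i. f i mod n) [0..<l]))"
proof
  \<comment> \<open>The first index whose value wraps, or \<open>l\<close> if none does.\<close>
  define k where "k = (LEAST i. i = l \<or> n \<le> f i)"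
  show "k \<le> l"
    unfolding k_def by (rule Least_le) simp
  have lo: "f i < n" if "i < k" for i
    using not_less_Least[of i "\<lambda>i. i = l \<or> n \<le> f i"] that by (auto simp: k_def)
  have hi: "n \<le> f i" if "k \<le> i" "i < l" for i
  proof -
    have "k = l \<or> n \<le> f k"
      unfolding k_def by (rule LeastI[of _ l]) simp
    moreover have "f k \<le> f i"
      using f(1) that(1) by (simp add: strict_mono_less_eq)
    ultimately show ?thesis using that by auto
  qed
  have hi': "f i mod n = f i - n" if "k \<le> i" "i < l" for i
    using hi[OF that] f(2) f(3)[OF that(2)] by (simp add: mod_if)
  show "sorted_wrt (<) (rotate k (map (\<lambda>i. f i mod n) [0..<l]))"
  proof (unfold sorted_wrt_iff_nth_less, intro allI impI)
    fix i j assume ij: "i < j" "j < length (rotate k (map (\<lambda>i. f i mod n) [0..<l]))"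
    then have j: "j < l" by simp
    \<comment> \<open>The wrapped block comes first: the two indices lie both in it, one in each
      block, or both in the unwrapped block.\<close>
    consider "k + j < l" | "k + i < l" "l \<le> k + j" | "l \<le> k + i"
      by linarith
    then have "f ((k + i) mod l) mod n < f ((k + j) mod l) mod n"
    proof cases
      case 1
      then show ?thesis
        using ij hi[of "k + i"] hi[of "k + j"] strict_monoD[OF f(1), of "k + i" "k + j"]
        by (simp add: hi')
    next
      case 2
      have "(k + j) mod l = k + j - l" "k + j - l < k"
        using 2 j \<open>k \<le> l\<close> by (auto simp: mod_if)
      \<comment> \<open>A wrapped value is below \<open>f 0\<close>, hence below every unwrapped
        one.\<close>
      moreover have "f 0 \<le> f (k + j - l)"
        using f(1) by (simp add: strict_mono_less_eq)
      ultimately show ?thesis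
        using 2 f(3)[of "k + i"] hi[of "k + i"] lo[of "k + j - l"] by (simp add: hi')
    next
      case 3
      have "(k + j) mod l = k + j - l" "k + j - l < k" "(k + i) mod l = k + i - l" "k + i - l < k"
        using 3 ij j \<open>k \<le> l\<close> by (auto simp: mod_if)
      then show ?thesis
        using 3 ij lo[of "k + j - l"] lo[of "k + i - l"]
          strict_monoD[OF f(1), of "k + i - l" "k + j - l"] by simp
    qed
    moreover have "(k + i) mod l < l" "(k + j) mod l < l"
      using j by auto
    ultimately show "rotate k (map (\<lambda>i. f i mod n) [0..<l]) ! i
        < rotate k (map (\<lambda>i. f i mod n) [0..<l]) ! j"
      using ij by (simp add: nth_rotate)
  qed
qed

text \<open>Undoing the rotation that sorts the marks restores the order of marking;
  \<open>A\<close> is where the first mark sits among the ones.\<close>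

lemma rotate_ones_encode:
  assumes "l > 0" "mark l s x 0 < 2 ^ l" "mark l s x (l - 1) < mark l s x 0 + 2 ^ l"
  obtains A where "A < l" "rotate A (ones (encode l s x)) = map (\<lambda>i. mark l s x i mod 2 ^ l) [0..<l]"
proof -
  let ?P = "map (\<lambda>i. mark l s x i mod 2 ^ l) [0..<l]"
  have "mark l s x i < mark l s x 0 + 2 ^ l" if "i < l" for i
  proof -
    have "mark l s x i \<le> mark l s x (l - 1)"
      using that strict_mono_mark[of l s x] by (simp add: strict_mono_less_eq)
    then show ?thesis using assms(3) by linarith
  qed
  then obtain k where k: "k \<le> l" "sorted_wrt (<) (rotate k ?P)"
    using sorted_rotate_mod[OF strict_mono_mark assms(2)] by blast
  have "set (rotate k ?P) = (\<lambda>i. mark l s x i mod 2 ^ l) ` {..<l}"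
    by auto
  then have "ones (encode l s x) = rotate k ?P"
    using k(2) unfolding ones_encode[OF assms(1)]
    by (metis strict_sorted_iff sorted_list_of_set.idem_if_sorted_distinct)
  \<comment> \<open>The \<open>mod l\<close> covers \<open>k = 0\<close>, where \<open>l - k\<close>
    is not a valid index.\<close>
  then have "rotate ((l - k) mod l) (ones (encode l s x)) = rotate (l - k + k) ?P"
    using rotate_conv_mod[of "l - k" "rotate k ?P"] by (simp add: rotate_rotate)
  also have "\<dots> = ?P"
    using k(1) by simp
  finally show ?thesis
    using that assms(1) by (meson mod_less_divisor)
qed

section \<open>Gap vectors\<close>

text \<open>A gap depends only on two cyclically adjacent entries, and stepping back by one commutes
  with a shift of indices modulo \<open>l\<close>.\<close>

lemma gaps_rotate:
  assumes "length js = l"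
  shows "gaps l (rotate A js) = rotate A (gaps l js)"
proof (rule nth_equalityI)
  fix m assume "m < length (gaps l (rotate A js))"
  then have m: "m < l" by (simp add: gaps_def)
  then have lt: "(A + m) mod l < l" "(m + l - 1) mod l < l"
    by auto
  have "(A + (m + l - 1) mod l) mod l = (A + m + (l - 1)) mod l"
    using m by (simp only: mod_add_right_eq) (simp add: add.assoc)
  also have "\<dots> = ((A + m) mod l + (l - 1)) mod l"
    by (simp add: mod_simps)
  also have "\<dots> = ((A + m) mod l + l - 1) mod l"
    using m by simp
  finally show "gaps l (rotate A js) ! m = rotate A (gaps l js) ! m"
    using m lt assms by (simp add: gaps_def nth_rotate)
qed (simp add: gaps_def)

text \<open>Consecutive marks differ by one plus an offset, while entry \<open>0\<close> closes the
  circle from the last mark to the first. The span bound lets \<open>mod\<close> be dropped.\<close>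

lemma gaps_marks:
  assumes "mark l s x (l - 1) < mark l s x 0 + 2 ^ l" "i < l"
  shows "gaps l (map (\<lambda>i. mark l s x i mod 2 ^ l) [0..<l]) ! i =
    (if i = 0 then 2 ^ l - 1 - (int (mark l s x (l - 1)) - int (mark l s x 0))
     else int (offset l s x (l - i)))"
proof -
  let ?f = "mark l s x"
  have "gaps l (map (\<lambda>i. ?f i mod 2 ^ l) [0..<l]) ! i =
      (int (?f i) mod 2 ^ l - int (?f ((i + l - 1) mod l)) mod 2 ^ l - 1) mod 2 ^ l"
    using assms(2) by (simp add: gaps_def zmod_int)
  also have "\<dots> = (int (?f i) - int (?f ((i + l - 1) mod l)) - 1) mod 2 ^ l"
    by (rule mod_diff_cong) (simp_all add: mod_diff_eq)
  finally have gap: "gaps l (map (\<lambda>i. ?f i mod 2 ^ l) [0..<l]) ! i =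
      (int (?f i) - int (?f ((i + l - 1) mod l)) - 1) mod 2 ^ l" .
  show ?thesis
  proof (cases i)
    case 0
    then have "gaps l (map (\<lambda>i. ?f i mod 2 ^ l) [0..<l]) ! i =
        (int (?f 0) - int (?f (l - 1)) - 1) mod 2 ^ l"
      using gap assms(2) by simp
    also have "\<dots> = (2 ^ l - 1 - (int (?f (l - 1)) - int (?f 0))) mod 2 ^ l"
      by (simp add: mod_eq_dvd_iff)
    also have "\<dots> = 2 ^ l - 1 - (int (?f (l - 1)) - int (?f 0))"
    proof (rule mod_pos_pos_trivial)
      have "?f 0 \<le> ?f (l - 1)"
        using strict_mono_mark[of l s x] by (simp add: strict_mono_less_eq)
      then show "2 ^ l - 1 - (int (?f (l - 1)) - int (?f 0)) < 2 ^ l"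
        by simp
      have "int (?f (l - 1)) < int (?f 0 + 2 ^ l)"
        using assms(1) by (simp only: of_nat_less_iff)
      then show "0 \<le> 2 ^ l - 1 - (int (?f (l - 1)) - int (?f 0))"
        by simp
    qed
    finally show ?thesis using 0 by simp
  next
    case (Suc m)
    \<comment> \<open>A single increment is at most the whole span of the marks.\<close>
    have "?f (Suc m) \<le> ?f (l - 1)" "?f 0 \<le> ?f m"
      using assms(2) Suc strict_mono_mark[of l s x] by (auto simp: strict_mono_less_eq)
    then have "offset l s x (l - i) < 2 ^ l"
      using assms(1) Suc by (simp add: mark_Suc)
    then have "int (offset l s x (l - i)) < 2 ^ l"
      by (metis of_nat_less_iff of_nat_numeral of_nat_power)
    moreover have "(m + l) mod l = m"
      using assms(2) Suc by simp
    ultimately show ?thesis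
      using gap Suc by (simp add: mark_Suc)
  qed
qed

section \<open>Uniqueness of the anchor\<close>

text \<open>The encoder enters only through \<open>g0\<close> and \<open>gi\<close>:
  \<open>d i\<close> stands for the value of block \<open>i\<close>, and \<open>A\<close> for the
  index of the first mark.\<close>

lemma is_anchor_iff:
  fixes d :: "nat \<Rightarrow> int"
  assumes l: "l \<ge> 2" and s: "anchor_decodable l s" and g: "length g = l" and A: "A < l"
    and d: "\<And>i. i \<in> {1..<l} \<Longrightarrow> d i < 2 ^ s i"
    and g0: "rotate A g ! 0 = 2 ^ l - 1 - (\<Sum>i = 1..l - 1. d i + 1)"
    and gi: "\<And>i. i \<in> {1..<l} \<Longrightarrow> rotate A g ! i = d (l - i)"
  shows "is_anchor l s g B \<longleftrightarrow> B = A"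
proof -
  let ?\<gamma> = "gamma_vec l s"
  let ?\<delta> = "rotate A g"
  have len: "length ?\<gamma> = l"
    using l by (simp add: gamma_vec_def)
  have \<gamma>0: "?\<gamma> ! 0 = 2 ^ l - 1 - (\<Sum>i = 1..l - 1. 2 ^ s i)"
    by (simp add: gamma_vec_def)
  have \<gamma>i: "?\<gamma> ! i = 2 ^ s (l - i) - 1" if "i \<in> {1..<l}" for i
    using that by (cases i) (auto simp: gamma_vec_def rev_nth Suc_diff_Suc)
  have s_le: "(2 ^ s i :: int) \<le> 2 ^ s (l - 1)" if "i \<in> {1..<l}" for i
  proof -
    have "s i \<le> s (l - 1)"
      by (rule mono_onD[of "{1..l}"]) (use s l that in \<open>auto simp: anchor_decodable_def\<close>)
    then show ?thesis by (simp add: power_increasing)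
  qed
  have top: "2 ^ s (l - 1) - 1 \<le> ?\<gamma> ! 0"
    using s \<gamma>0 by (simp add: anchor_decodable_def)
  have \<gamma>_le: "?\<gamma> ! i \<le> ?\<gamma> ! 0" if "i < l" for i
  proof (cases "i = 0")
    case False
    then have "i \<in> {1..<l}" "l - i \<in> {1..<l}"
      using that by auto
    then show ?thesis
      using top s_le[of "l - i"] \<gamma>i[of i] by linarith
  qed simp
  have d_le: "(\<Sum>i = 1..l - 1. d i + 1) \<le> (\<Sum>i = 1..l - 1. 2 ^ s i)"
  proof (rule sum_mono)
    fix i assume "i \<in> {1..l - 1}"
    then have "i \<in> {1..<l}" using l by auto
    from d[OF this] show "d i + 1 \<le> 2 ^ s i" by simp
  qed
  have \<delta>_lt: "?\<delta> ! i \<le> ?\<gamma> ! 0" if "i \<in> {1..<l}" for i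
  proof -
    have "l - i \<in> {1..<l}"
      using that by auto
    then show ?thesis
      using that top s_le[of "l - i"] gi[of i] d[of "l - i"] by linarith
  qed
  have eq: "?\<delta> = ?\<gamma>" if "?\<delta> ! 0 \<le> ?\<gamma> ! 0"
  proof (rule nth_equalityI)
    \<comment> \<open>The excess of \<delta> over \<gamma> at entry \<open>0\<close> is the sum of
      the slacks elsewhere; these are nonnegative, so all vanish.\<close>
    have "(\<Sum>i = 1..l - 1. 2 ^ s i - (d i + 1)) = 0"
      using that d_le g0 \<gamma>0 by (simp add: sum_subtractf)
    moreover have "0 \<le> 2 ^ s i - (d i + 1)" if "i \<in> {1..l - 1}" for i
      using d[of i] that l by fastforce
    ultimately have "\<forall>i \<in> {1..l - 1}. 2 ^ s i - (d i + 1) = 0"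
      by (subst (asm) sum_nonneg_eq_0_iff) auto
    then have *: "d i = 2 ^ s i - 1" if "i \<in> {1..<l}" for i
      using that by force
    fix i assume "i < length ?\<delta>"
    then have "i < l" using g by simp
    show "?\<delta> ! i = ?\<gamma> ! i"
    proof (cases "i = 0")
      case True
      then show ?thesis using \<open>?\<delta> ! 0 \<le> ?\<gamma> ! 0\<close> d_le g0 \<gamma>0 by simp
    next
      case False
      then show ?thesis using \<open>i < l\<close> gi[of i] \<gamma>i[of i] *[of "l - i"] by auto
    qed
  qed (use g len in simp)
  show ?thesis
  proof (cases "\<exists>n0 < l. rotate n0 g = ?\<gamma>")
    case True
    \<comment> \<open>Rotations have the same entries, so the head of \<delta> is an entry of
      \<gamma> and thus at most its maximum.\<close>
    then have "set ?\<delta> = set ?\<gamma>"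
      by (metis set_rotate)
    moreover have "?\<delta> ! 0 \<in> set ?\<delta>"
      using g l by (intro nth_mem) simp
    ultimately have "?\<delta> ! 0 \<le> ?\<gamma> ! 0"
      using \<gamma>_le len by (metis in_set_conv_nth)
    then have \<delta>\<gamma>: "?\<delta> = ?\<gamma>"
      by (rule eq)
    have uniq: "\<not> a < b" if "b < l" "rotate a g = ?\<gamma>" "rotate b g = ?\<gamma>" for a b
    proof
      assume "a < b"
      then have "rotate (b - a) ?\<gamma> = ?\<gamma>"
        using that by (metis rotate_rotate le_add_diff_inverse2 less_imp_le)
      moreover have "0 < b - a" "b - a < l"
        using \<open>a < b\<close> that by auto
      ultimately show False
        using s by (auto simp: anchor_decodable_def)
    qed
    have "is_anchor l s g B \<longleftrightarrow> B < l \<and> rotate B g = ?\<gamma>"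
      using True by (simp add: is_anchor_def)
    also have "\<dots> \<longleftrightarrow> B = A"
      using uniq[of A B] uniq[of B A] A \<delta>\<gamma> by (metis nat_neq_iff)
    finally show ?thesis .
  next
    case False
    then have "?\<gamma> ! 0 < ?\<delta> ! 0"
      using eq A by force
    then have *: "?\<delta> ! i < ?\<delta> ! 0" if "i \<in> {1..<l}" for i
      using \<delta>_lt[OF that] by linarith
    have **: "g ! m < g ! A" if "m < l" "m \<noteq> A" for m
    proof -
      \<comment> \<open>The cyclic distance from \<open>A\<close> to \<open>m\<close>, which is the
        index of \<open>g ! m\<close> in the rotated vector.\<close>
      let ?i = "(m + (l - A)) mod l"
      have "(A + ?i) mod l = (m + l) mod l"
        using A by (simp add: mod_simps)
      then have m: "(A + ?i) mod l = m"
        using that(1) by simp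
      moreover have "?i < l" using l by simp
      moreover have "?i \<noteq> 0"
        using m that(2) A by (metis add.right_neutral mod_less)
      ultimately show ?thesis
        using *[of ?i] g A l by (simp add: nth_rotate)
    qed
    have "is_anchor l s g B \<longleftrightarrow> B < l \<and> is_arg_max ((!) g) (\<lambda>m. m < l) B"
      using False by (auto simp: is_anchor_def)
    also have "\<dots> \<longleftrightarrow> B = A"
      using ** A unfolding is_arg_max_def by (metis less_asym)
    finally show ?thesis .
  qed
qed

section \<open>Correctness of decoding\<close>

lemma decode_encode:
  assumes l: "l \<ge> 2" and s: "anchor_decodable l s" and x: "length x = total_bits l s"
  shows "decode l s (encode l s x) = Some x"
proof -
  let ?f = "mark l s x" and ?e = "offset l s x" and ?js = "ones (encode l s x)"
  let ?P = "map (\<lambda>i. ?f i mod 2 ^ l) [0..<l]"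
  have e: "int (?e j) < 2 ^ s j" if "j \<in> {1..l}" for j
    using dec_bounds(2)[of "block l s x j"] length_block[OF x that] by (simp add: int_offset)
  have "int (?f m) - int (?f 0) = (\<Sum>i = 1..m. int (?e (l - i)) + 1)" for m
    by (induction m) (auto simp: mark_Suc)
  then have "int (?f (l - 1)) - int (?f 0) = (\<Sum>i = 1..l - 1. int (?e (l - i)) + 1)" .
  also have "\<dots> = (\<Sum>i = 1..l - 1. int (?e i) + 1)"
    by (rule sum.reindex_bij_witness[of _ "\<lambda>i. l - i" "\<lambda>i. l - i"]) auto
  finally have diff: "int (?f (l - 1)) - int (?f 0) = (\<Sum>i = 1..l - 1. int (?e i) + 1)" .
  have "\<dots> \<le> (\<Sum>i = 1..l - 1. 2 ^ s i)"
  proof (rule sum_mono)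
    fix i assume "i \<in> {1..l - 1}"
    then have "i \<in> {1..l}" by auto
    from e[OF this] show "int (?e i) + 1 \<le> 2 ^ s i" by linarith
  qed
  \<comment> \<open>The inequality in \<open>anchor_decodable\<close> keeps all marks within one
    turn of the circle.\<close>
  also have "\<dots> \<le> 2 ^ l - 2 ^ s (l - 1)"
    using s by (simp add: anchor_decodable_def)
  also have "\<dots> < (2 ^ l :: int)"
    by simp
  finally have "int (?f (l - 1)) < int (?f 0 + 2 ^ l)"
    using diff by simp
  then have bound: "?f (l - 1) < ?f 0 + 2 ^ l"
    by (simp only: of_nat_less_iff)
  \<comment> \<open>As \<open>s l = l\<close>, the first mark needs no reduction, so its position is
    the value of the first block.\<close>
  have "int (?e l) < int (2 ^ l)"
    using e[of l] s l by (simp add: anchor_decodable_def)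
  then have f0: "?f 0 < 2 ^ l"
    by (simp only: mark_0 of_nat_less_iff)
  have "l > 0" using l by simp
  from rotate_ones_encode[OF this f0 bound] obtain A where
    A: "A < l" and js: "rotate A ?js = ?P" .
  have len: "length ?js = l"
    by (metis js length_map length_rotate length_upt diff_zero)
  let ?g = "gaps l ?js"
  have len_g: "length ?g = l" by (simp add: gaps_def)
  have g: "rotate A ?g = gaps l ?P"
    using gaps_rotate[OF len, of A] js by simp
  have gi: "rotate A ?g ! i = int (?e (l - i))" if "i \<in> {1..<l}" for i
    using that gaps_marks[OF bound, of i] g by auto
  have "is_anchor l s ?g B \<longleftrightarrow> B = A" for B
  proof (rule is_anchor_iff[OF l s len_g A, of "\<lambda>i. int (?e i)"])
    show "rotate A ?g ! 0 = 2 ^ l - 1 - (\<Sum>i = 1..l - 1. int (?e i) + 1)"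
      using gaps_marks[OF bound, of 0] g diff l by simp
  qed (use e gi in auto)
  then have ex1: "\<exists>!A. is_anchor l s ?g A" and the: "(THE A. is_anchor l s ?g A) = A"
    by auto
  have "?js ! A = ?P ! 0"
    using js A len l nth_rotate[of 0 ?js A] by simp
  then have anchor: "?js ! A = ?e l"
    using f0 l by (simp add: mark_0)
  have block: "bin_rep (s j) (int (?e j)) = Some (block l s x j)" if "j \<in> {1..l}" for j
    using length_block[OF x that] by (simp add: bin_rep_eq_Some_iff int_offset)
  have "?g ! ((A + i) mod l) = int (?e (l - i))" if "i \<in> {1..<l}" for i
    using gi[OF that] that len_g by (simp add: nth_rotate)
  then have "bin_rep l (int (?js ! A)) #
      map (\<lambda>i. bin_rep (s (l - i)) (?g ! ((A + i) mod l))) [1..<l] =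
      map (\<lambda>i. Some (block l s x (l - i))) [0..<l]"
    using block[of l] anchor l s
    by (auto simp: upt_conv_Cons[of 0] anchor_decodable_def intro!: block)
  moreover have "those (map (\<lambda>i. Some (h i)) is) = Some (map h is)" for h :: "nat \<Rightarrow> bool list" and "is"
    by (induction "is") auto
  ultimately show ?thesis
    using ex1 the len concat_blocks[OF x] by (simp add: decode_def Let_def del: those.simps)
qed

theorem theorem2p3:
  fixes l :: nat and s :: "nat \<Rightarrow> nat"
  assumes "l \<ge> 3" and "anchor_decodable l s"
  shows "inj_on (encode l s) (bitvecs (total_bits l s)) \<and>
         (\<forall>x \<in> bitvecs (total_bits l s). decode l s (encode l s x) = Some x)"
proof -
  have "\<forall>x \<in> bitvecs (total_bits l s). decode l s (encode l s x) = Some x"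
    using assms by (auto simp: bitvecs_def intro: decode_encode)
  moreover from this have "inj_on (encode l s) (bitvecs (total_bits l s))"
    by (metis inj_onI option.inject)
  ultimately show ?thesis by blast
qed

end
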